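(* Let $(A;d,\cdot,l_3)$ be an associative 2-algebra and let $\psi:A_1\to A_0$, $\omega:A_0\otimes A_0\to A_0$, $\mu:A_0\otimes A_1\to A_1$, $\nu:A_1\otimes A_0\to A_1$, $\theta:A_0\otimes A_0\otimes A_0\to A_1$ be linear maps. Then $(\psi,\omega,\mu,\nu,\theta)$ generates a 1-parameter infinitesimal deformation of $A$ if and only if both of the following hold: (i) $(\psi,\omega,\mu,\nu,\theta)$ is a 2-cocycle of $A$ with coefficients in the adjoint representation; (ii) $(\psi,\omega,\mu,\nu,\theta)$ itself defines an associative 2-algebra structure on the graded vector space $A_0\oplus A_1$, i.e. the differential $\psi$, the products $\omega$ (on $A_0\otimes A_0$), $\mu$ (on $A_0\otimes A_1$), $\nu$ (on $A_1\otimes A_0$) and the trilinear map $\theta$ satisfy all the axioms of an associative 2-algebra.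
   Context: All vector spaces are over a fixed field. An associative 2-algebra $A=A_1\oplus A_0$, written $(A;d,\cdot,l_3)$, consists of a linear map $d:A_1\to A_0$, bilinear products $A_i\otimes A_j\to A_{i+j}$ for $0\le i+j\le 1$ (all written $\cdot$), and a trilinear map $l_3:A_0\otimes A_0\otimes A_0\to A_1$ such that for all $x,y,z,t\in A_0$, $a,b\in A_1$: (a) $d(x\cdot a)=x\cdot da$; (b) $d(a\cdot x)=da\cdot x$; (c) $da\cdot b=a\cdot db$; (d) $d\,l_3(x,y,z)=(x\cdot y)\cdot z-x\cdot(y\cdot z)$; (e1) $l_3(x,y,da)=(x\cdot y)\cdot a-x\cdot(y\cdot a)$; (e2) $l_3(x,da,y)=(x\cdot a)\cdot y-x\cdot(a\cdot y)$; (e3) $l_3(da,x,y)=(a\cdot x)\cdot y-a\cdot(x\cdot y)$; (f) $x\cdot l_3(y,z,t)+l_3(x,y,z)\cdot t=l_3(x\cdot y,z,t)-l_3(x,y\cdot z,t)+l_3(x,y,z\cdot t)$. Deformation. Put $d^\lambda(a)=da+\lambda\psi(a)$, $x\cdot_\lambda y=x\cdot y+\lambda\omega(x,y)$, $x\cdot_\lambda a=x\cdot a+\lambda\mu(x,a)$, $a\cdot_\lambda x=a\cdot x+\lambda\nu(a,x)$, $l_3^\lambda(x,y,z)=l_3(x,y,z)+\lambda\theta(x,y,z)$. One says that $(\psi,\omega,\mu,\nu,\theta)$ generates a 1-parameter infinitesimal deformation of $A$ if $(d^\lambda,\cdot_\lambda,l_3^\lambda)$ satisfies the axioms of an associative 2-algebra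 on $A_0\oplus A_1$, where $\lambda$ is a formal parameter (i.e. the axioms hold as polynomial identities in $\lambda$). 2-cocycles with adjoint coefficients. $(\psi,\omega,\mu,\nu,\theta)$ is a 2-cocycle of $A$ with coefficients in the adjoint representation (that is, $A$ acting on itself by its own products and $l_3$) if for all $x,y,z,t\in A_0$, $a,b\in A_1$: (1) $x\cdot\psi(a)-\psi(x\cdot a)+\omega(x,da)-d\mu(x,a)=0$; (2) $\psi(a)\cdot x-\psi(a\cdot x)+\omega(da,x)-d\nu(a,x)=0$; (3) $a\cdot\psi(b)+\nu(a,db)-\psi(a)\cdot b-\mu(da,b)=0$; (4) $\omega(x,y)\cdot z-x\cdot\omega(y,z)+\omega(x\cdot y,z)-\omega(x,y\cdot z)=d\theta(x,y,z)+\psi(l_3(x,y,z))$; (5) $\omega(x,y)\cdot a-x\cdot\mu(y,a)+\mu(x\cdot y,a)-\mu(x,y\cdot a)=\theta(x,y,da)+l_3(x,y,\psi(a))$; (6) $\mu(x,a)\cdot y-x\cdot\nu(a,y)+\nu(x\cdot a,y)-\mu(x,a\cdot y)=\theta(x,da,y)+l_3(x,\psi(a),y)$; (7) $\nu(a,x)\cdot y-a\cdot\omega(x,y)+\nu(a\cdot x,y)-\nu(a,x\cdot y)=\theta(da,x,y)+l_3(\psi(a),x,y)$; (8) $x\cdot\theta(y,z,t)+\theta(x,y,z)\cdot t+\mu(x,l_3(y,z,t))+\nu(l_3(x,y,z),t)=\theta(x\cdot y,z,t)-\theta(x,y\cdot z,t)+\theta(x,y,z\cdot t)+l_3(\omega(x,y),z,t)-l_3(x,\omega(y,z),t)+l_3(x,y,\omega(z,t))$.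 *)

theory Defs
  imports "HOL-Computational_Algebra.Polynomial"
begin

definition bilinear_map ::
  "('k::comm_ring_1 \<Rightarrow> 'u::ab_group_add \<Rightarrow> 'u) \<Rightarrow> ('k \<Rightarrow> 'v::ab_group_add \<Rightarrow> 'v) \<Rightarrow>
   ('k \<Rightarrow> 'w::ab_group_add \<Rightarrow> 'w) \<Rightarrow> ('u \<Rightarrow> 'v \<Rightarrow> 'w) \<Rightarrow> bool"
  where "bilinear_map su sv sw f \<longleftrightarrow>
    (\<forall>x. module_hom sv sw (\<lambda>y. f x y)) \<and> (\<forall>y. module_hom su sw (\<lambda>x. f x y))"

definition trilinear_map ::
  "('k::comm_ring_1 \<Rightarrow> 'u::ab_group_add \<Rightarrow> 'u) \<Rightarrow> ('k \<Rightarrow> 'v::ab_group_add \<Rightarrow> 'v) \<Rightarrow>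
   ('k \<Rightarrow> 't::ab_group_add \<Rightarrow> 't) \<Rightarrow> ('k \<Rightarrow> 'w::ab_group_add \<Rightarrow> 'w) \<Rightarrow>
   ('u \<Rightarrow> 'v \<Rightarrow> 't \<Rightarrow> 'w) \<Rightarrow> bool"
  where "trilinear_map su sv st sw f \<longleftrightarrow>
    (\<forall>x y. module_hom st sw (\<lambda>z. f x y z)) \<and>
    (\<forall>x z. module_hom sv sw (\<lambda>y. f x y z)) \<and>
    (\<forall>y z. module_hom su sw (\<lambda>x. f x y z))"

text \<open>
  The data underlying a candidate 2-algebra structure on \<open>A\<^sub>0 \<oplus> A\<^sub>1\<close>, without any axiom except
  linearity. The types \<open>'a\<close> and \<open>'b\<close> are \<open>A\<^sub>0\<close> and \<open>A\<^sub>1\<close>, with scalar actions \<open>s0\<close> and \<open>s1\<close>.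
  The three products \<open>A\<^sub>0 \<otimes> A\<^sub>0 \<rightarrow> A\<^sub>0\<close>, \<open>A\<^sub>0 \<otimes> A\<^sub>1 \<rightarrow> A\<^sub>1\<close>, \<open>A\<^sub>1 \<otimes> A\<^sub>0 \<rightarrow> A\<^sub>1\<close> are \<open>m\<close>, \<open>l\<close>, \<open>r\<close>.
  Scalars range over a commutative ring and not only over a field, so that the same notion
  applies over \<open>k[\<lambda>]\<close>.
\<close>

locale two_algebra_data =
  fixes s0 :: "'k::comm_ring_1 \<Rightarrow> 'a::ab_group_add \<Rightarrow> 'a"
    and s1 :: "'k \<Rightarrow> 'b::ab_group_add \<Rightarrow> 'b"
    and d :: "'b \<Rightarrow> 'a"
    and m :: "'a \<Rightarrow> 'a \<Rightarrow> 'a"  (infixl \<open>\<cdot>\<close> 70)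
    and l :: "'a \<Rightarrow> 'b \<Rightarrow> 'b"  (infixl \<open>\<rhd>\<close> 70)
    and r :: "'b \<Rightarrow> 'a \<Rightarrow> 'b"  (infixl \<open>\<lhd>\<close> 70)
    and l3 :: "'a \<Rightarrow> 'a \<Rightarrow> 'a \<Rightarrow> 'b"
  assumes d_linear: "module_hom s1 s0 d"
    and m_bilinear: "bilinear_map s0 s0 s0 m"
    and l_bilinear: "bilinear_map s0 s1 s1 l"
    and r_bilinear: "bilinear_map s1 s0 s1 r"
    and l3_trilinear: "trilinear_map s0 s0 s0 s1 l3"

locale associative_2_algebra = two_algebra_data +
  assumes d_l: "d (x \<rhd> a) = x \<cdot> d a"
    and d_r: "d (a \<lhd> x) = d a \<cdot> x"
    and peiffer: "d a \<rhd> b = a \<lhd> d b"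
    and d_l3: "d (l3 x y z) = (x \<cdot> y) \<cdot> z - x \<cdot> (y \<cdot> z)"
    and l3_d3: "l3 x y (d a) = (x \<cdot> y) \<rhd> a - x \<rhd> (y \<rhd> a)"
    and l3_d2: "l3 x (d a) y = (x \<rhd> a) \<lhd> y - x \<rhd> (a \<lhd> y)"
    and l3_d1: "l3 (d a) x y = (a \<lhd> x) \<lhd> y - a \<lhd> (x \<cdot> y)"
    and pentagon: "x \<rhd> l3 y z t + l3 x y z \<lhd> t
      = l3 (x \<cdot> y) z t - l3 x (y \<cdot> z) t + l3 x y (z \<cdot> t)"

definition (in two_algebra_data) adjoint_2_cocycle ::
  "('b \<Rightarrow> 'a) \<Rightarrow> ('a \<Rightarrow> 'a \<Rightarrow> 'a) \<Rightarrow> ('a \<Rightarrow> 'b \<Rightarrow> 'b) \<Rightarrow> ('b \<Rightarrow> 'a \<Rightarrow> 'b) \<Rightarrow>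
   ('a \<Rightarrow> 'a \<Rightarrow> 'a \<Rightarrow> 'b) \<Rightarrow> bool"
  where "adjoint_2_cocycle \<psi> \<omega> \<mu> \<nu> \<theta> \<longleftrightarrow>
    (\<forall>x a. x \<cdot> \<psi> a - \<psi> (x \<rhd> a) + \<omega> x (d a) - d (\<mu> x a) = 0) \<and>
    (\<forall>x a. \<psi> a \<cdot> x - \<psi> (a \<lhd> x) + \<omega> (d a) x - d (\<nu> a x) = 0) \<and>
    (\<forall>a b. a \<lhd> \<psi> b + \<nu> a (d b) - \<psi> a \<rhd> b - \<mu> (d a) b = 0) \<and>
    (\<forall>x y z. \<omega> x y \<cdot> z - x \<cdot> \<omega> y z + \<omega> (x \<cdot> y) z - \<omega> x (y \<cdot> z)
      = d (\<theta> x y z) + \<psi> (l3 x y z)) \<and>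
    (\<forall>x y a. \<omega> x y \<rhd> a - x \<rhd> \<mu> y a + \<mu> (x \<cdot> y) a - \<mu> x (y \<rhd> a)
      = \<theta> x y (d a) + l3 x y (\<psi> a)) \<and>
    (\<forall>x y a. \<mu> x a \<lhd> y - x \<rhd> \<nu> a y + \<nu> (x \<rhd> a) y - \<mu> x (a \<lhd> y)
      = \<theta> x (d a) y + l3 x (\<psi> a) y) \<and>
    (\<forall>x y a. \<nu> a x \<lhd> y - a \<lhd> \<omega> x y + \<nu> (a \<lhd> x) y - \<nu> a (x \<cdot> y)
      = \<theta> (d a) x y + l3 (\<psi> a) x y) \<and>
    (\<forall>x y z t. x \<rhd> \<theta> y z t + \<theta> x y z \<lhd> t + \<mu> x (l3 y z t) + \<nu> (l3 x y z) t
      = \<theta> (x \<cdot> y) z t - \<theta> x (y \<cdot> z) t + \<theta> x y (z \<cdot> t)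
        + l3 (\<omega> x y) z t - l3 x (\<omega> y z) t + l3 x y (\<omega> z t))"

text \<open>
  The formal parameter: for a \<open>k\<close>-vector space \<open>V\<close>, the type \<open>V poly\<close> is \<open>V[\<lambda>] = k[\<lambda>] \<otimes> V\<close>, and
  multiplication by \<open>\<lambda>\<close> is \<open>pCons 0\<close>. The following are the \<open>\<lambda>\<close>-linear extensions to \<open>V[\<lambda>]\<close> of
  (multi)linear maps given on constants, with values in \<open>W[\<lambda>]\<close>.
\<close>

definition lam_pow :: "nat \<Rightarrow> 'w::zero poly \<Rightarrow> 'w poly"
  where "lam_pow n = (pCons 0 ^^ n)"

definition lam_ext1 ::
  "('u::zero \<Rightarrow> 'w::comm_monoid_add poly) \<Rightarrow> 'u poly \<Rightarrow> 'w poly"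
  where "lam_ext1 f p = (\<Sum>i\<le>degree p. lam_pow i (f (coeff p i)))"

definition lam_ext2 ::
  "('u::zero \<Rightarrow> 'v::zero \<Rightarrow> 'w::comm_monoid_add poly) \<Rightarrow> 'u poly \<Rightarrow> 'v poly \<Rightarrow> 'w poly"
  where "lam_ext2 f p q =
    (\<Sum>i\<le>degree p. \<Sum>j\<le>degree q. lam_pow (i + j) (f (coeff p i) (coeff q j)))"

definition lam_ext3 ::
  "('u::zero \<Rightarrow> 'v::zero \<Rightarrow> 't::zero \<Rightarrow> 'w::comm_monoid_add poly) \<Rightarrow>
   'u poly \<Rightarrow> 'v poly \<Rightarrow> 't poly \<Rightarrow> 'w poly"
  where "lam_ext3 f p q s =
    (\<Sum>i\<le>degree p. \<Sum>j\<le>degree q. \<Sum>n\<le>degree s.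
      lam_pow (i + j + n) (f (coeff p i) (coeff q j) (coeff s n)))"

text \<open>The \<open>k[\<lambda>]\<close>-module structure of \<open>V[\<lambda>]\<close>.\<close>

definition lam_scale ::
  "('k::comm_ring_1 \<Rightarrow> 'v::ab_group_add \<Rightarrow> 'v) \<Rightarrow> 'k poly \<Rightarrow> 'v poly \<Rightarrow> 'v poly"
  where "lam_scale s = lam_ext2 (\<lambda>c v. [:s c v:])"

text \<open>
  Since \<open>\<lambda>\<close> is formal, the deformed operations live on \<open>A\<^sub>0[\<lambda>] \<oplus> A\<^sub>1[\<lambda>]\<close>, and the axioms are required
  over \<open>k[\<lambda>]\<close>. On constants the deformed operations are \<open>d a + \<lambda> \<psi> a\<close>, that is \<open>[:d a, \<psi> a:]\<close>,
  and similarly for the others.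
\<close>

definition (in two_algebra_data) generates_infinitesimal_deformation ::
  "('b \<Rightarrow> 'a) \<Rightarrow> ('a \<Rightarrow> 'a \<Rightarrow> 'a) \<Rightarrow> ('a \<Rightarrow> 'b \<Rightarrow> 'b) \<Rightarrow> ('b \<Rightarrow> 'a \<Rightarrow> 'b) \<Rightarrow>
   ('a \<Rightarrow> 'a \<Rightarrow> 'a \<Rightarrow> 'b) \<Rightarrow> bool"
  where "generates_infinitesimal_deformation \<psi> \<omega> \<mu> \<nu> \<theta> \<longleftrightarrow>
    associative_2_algebra (lam_scale s0) (lam_scale s1)
      (lam_ext1 (\<lambda>a. [:d a, \<psi> a:]))
      (lam_ext2 (\<lambda>x y. [:x \<cdot> y, \<omega> x y:]))
      (lam_ext2 (\<lambda>x a. [:x \<rhd> a, \<mu> x a:]))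
      (lam_ext2 (\<lambda>a x. [:a \<lhd> x, \<nu> a x:]))
      (lam_ext3 (\<lambda>x y z. [:l3 x y z, \<theta> x y z:]))"

end

theory Submission
  imports Defs
begin

text \<open>
  Every axiom of an associative 2-algebra is an equation between maps that are multiadditive and
  commute with multiplication by \<open>\<lambda>\<close> in each argument. Such an equation holds on all of
  \<open>A\<^sub>0[\<lambda>] \<oplus> A\<^sub>1[\<lambda>]\<close> as soon as it holds on constants (\<open>lam_linear_eq_iff\<close> and its versions for
  several arguments). On constants, both sides are polynomials of degree at most 2 in \<open>\<lambda>\<close>:
  the coefficients of \<open>\<lambda>\<^sup>0\<close> agree because \<open>A\<close> is an associative 2-algebra, equality of the
  coefficients of \<open>\<lambda>\<^sup>1\<close> is one of the cocycle equations, and equality of the coefficients of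
  \<open>\<lambda>\<^sup>2\<close> is the same axiom for \<open>(\<psi>, \<omega>, \<mu>, \<nu>, \<theta>)\<close>. The \<open>k[\<lambda>]\<close>-linearity of the deformed operations,
  and the module axioms for \<open>V[\<lambda>]\<close>, follow from linearity over \<open>k\<close> alone, again by
  comparison on constants.
\<close>

section \<open>Maps commuting with the formal parameter\<close>

text \<open>
  Additive maps \<open>V[\<lambda>] \<rightarrow> W[\<lambda>]\<close> that commute with multiplication by \<open>\<lambda>\<close>. No scalar from \<open>k\<close> occurs,
  so the notion applies in each argument of the scalar action itself.
\<close>

definition lam_linear :: "('v::ab_group_add poly \<Rightarrow> 'w::ab_group_add poly) \<Rightarrow> bool"
  where "lam_linear f \<longleftrightarrow>
    (\<forall>p q. f (p + q) = f p + f q) \<and> (\<forall>p. f (pCons 0 p) = pCons 0 (f p))"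

lemma lam_linearI:
  assumes "\<And>p q. f (p + q) = f p + f q" "\<And>p. f (pCons 0 p) = pCons 0 (f p)"
  shows "lam_linear f"
  using assms by (simp add: lam_linear_def)

lemma lam_linear_add: "lam_linear f \<Longrightarrow> f (p + q) = f p + f q"
  by (simp add: lam_linear_def)

lemma lam_linear_shift: "lam_linear f \<Longrightarrow> f (pCons 0 p) = pCons 0 (f p)"
  by (simp add: lam_linear_def)

lemma lam_linear_0:
  assumes "lam_linear f"
  shows "f 0 = 0"
  using lam_linear_add[OF assms, of 0 0] by simp

lemma lam_linear_pCons:
  assumes "lam_linear f"
  shows "f (pCons a p) = f [:a:] + pCons 0 (f p)"
proof -
  have "f (pCons a p) = f ([:a:] + pCons 0 p)" by simp
  then show ?thesis
    by (simp only: lam_linear_add[OF assms] lam_linear_shift[OF assms])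
qed

lemma lam_linear_ident: "lam_linear (\<lambda>p. p)"
  by (rule lam_linearI) simp_all

lemma lam_linear_compose: "lam_linear f \<Longrightarrow> lam_linear g \<Longrightarrow> lam_linear (\<lambda>p. f (g p))"
  by (simp add: lam_linear_def)

lemma lam_linear_plus: "lam_linear f \<Longrightarrow> lam_linear g \<Longrightarrow> lam_linear (\<lambda>p. f p + g p)"
  by (simp add: lam_linear_def)

lemma lam_linear_minus: "lam_linear f \<Longrightarrow> lam_linear g \<Longrightarrow> lam_linear (\<lambda>p. f p - g p)"
  by (simp add: lam_linear_def)

lemma lam_linear_mult_left: "lam_linear (\<lambda>p. p * q)"
  by (rule lam_linearI) (simp_all add: distrib_right)

lemma lam_linear_mult_right: "lam_linear (\<lambda>p. q * p)"
  by (rule lam_linearI) (simp_all add: distrib_left)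

lemma lam_linear_eqI:
  assumes f: "lam_linear f" and g: "lam_linear g" and eq: "\<And>x. f [:x:] = g [:x:]"
  shows "f p = g p"
proof (induction p)
  case 0
  show ?case by (simp add: lam_linear_0[OF f] lam_linear_0[OF g])
next
  case (pCons a p)
  then show ?case
    by (simp only: lam_linear_pCons[OF f, of a p] lam_linear_pCons[OF g, of a p] eq)
qed

lemma lam_linear_eq_iff:
  assumes "lam_linear f" "lam_linear g"
  shows "(\<forall>p. f p = g p) \<longleftrightarrow> (\<forall>x. f [:x:] = g [:x:])"
  using lam_linear_eqI[OF assms] by blast

lemma lam_linear_eq_iff2:
  assumes "\<And>q. lam_linear (\<lambda>p. f p q)" "\<And>q. lam_linear (\<lambda>p. g p q)"
    and "\<And>p. lam_linear (\<lambda>q. f p q)" "\<And>p. lam_linear (\<lambda>q. g p q)"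
  shows "(\<forall>p q. f p q = g p q) \<longleftrightarrow> (\<forall>x y. f [:x:] [:y:] = g [:x:] [:y:])"
proof -
  have "(\<forall>p q. f p q = g p q) \<longleftrightarrow> (\<forall>p x. f p [:x:] = g p [:x:])"
    using lam_linear_eq_iff[OF assms(3,4)] by simp
  also have "\<dots> \<longleftrightarrow> (\<forall>x p. f p [:x:] = g p [:x:])"
    by blast
  also have "\<dots> \<longleftrightarrow> (\<forall>x y. f [:y:] [:x:] = g [:y:] [:x:])"
    using lam_linear_eq_iff[OF assms(1,2)] by simp
  finally show ?thesis by blast
qed

lemma lam_linear_eq_iff3:
  assumes "\<And>q s. lam_linear (\<lambda>p. f p q s)" "\<And>q s. lam_linear (\<lambda>p. g p q s)"
    and "\<And>p s. lam_linear (\<lambda>q. f p q s)" "\<And>p s. lam_linear (\<lambda>q. g p q s)"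
    and "\<And>p q. lam_linear (\<lambda>s. f p q s)" "\<And>p q. lam_linear (\<lambda>s. g p q s)"
  shows "(\<forall>p q s. f p q s = g p q s) \<longleftrightarrow>
    (\<forall>x y z. f [:x:] [:y:] [:z:] = g [:x:] [:y:] [:z:])"
proof -
  have "(\<forall>p q s. f p q s = g p q s) \<longleftrightarrow> (\<forall>p x y. f p [:x:] [:y:] = g p [:x:] [:y:])"
    using lam_linear_eq_iff2[OF assms(3-6)] by simp
  also have "\<dots> \<longleftrightarrow> (\<forall>x y p. f p [:x:] [:y:] = g p [:x:] [:y:])"
    by blast
  also have "\<dots> \<longleftrightarrow> (\<forall>x y z. f [:z:] [:x:] [:y:] = g [:z:] [:x:] [:y:])"
    using lam_linear_eq_iff[OF assms(1,2)] by simp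
  finally show ?thesis by blast
qed

lemma lam_linear_eq_iff4:
  assumes "\<And>q s u. lam_linear (\<lambda>p. f p q s u)" "\<And>q s u. lam_linear (\<lambda>p. g p q s u)"
    and "\<And>p s u. lam_linear (\<lambda>q. f p q s u)" "\<And>p s u. lam_linear (\<lambda>q. g p q s u)"
    and "\<And>p q u. lam_linear (\<lambda>s. f p q s u)" "\<And>p q u. lam_linear (\<lambda>s. g p q s u)"
    and "\<And>p q s. lam_linear (\<lambda>u. f p q s u)" "\<And>p q s. lam_linear (\<lambda>u. g p q s u)"
  shows "(\<forall>p q s u. f p q s u = g p q s u) \<longleftrightarrow>
    (\<forall>x y z t. f [:x:] [:y:] [:z:] [:t:] = g [:x:] [:y:] [:z:] [:t:])"
proof -
  have "(\<forall>p q s u. f p q s u = g p q s u) \<longleftrightarrow>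
      (\<forall>p x y z. f p [:x:] [:y:] [:z:] = g p [:x:] [:y:] [:z:])"
    using lam_linear_eq_iff3[OF assms(3-8)] by simp
  also have "\<dots> \<longleftrightarrow> (\<forall>x y z p. f p [:x:] [:y:] [:z:] = g p [:x:] [:y:] [:z:])"
    by blast
  also have "\<dots> \<longleftrightarrow> (\<forall>x y z t. f [:t:] [:x:] [:y:] [:z:] = g [:t:] [:x:] [:y:] [:z:])"
    using lam_linear_eq_iff[OF assms(1,2)] by simp
  finally show ?thesis by blast
qed

section \<open>Extensions of additive maps\<close>

lemma lam_pow_0 [simp]: "lam_pow 0 p = p"
  by (simp add: lam_pow_def)

lemma lam_pow_Suc [simp]: "lam_pow (Suc n) p = pCons 0 (lam_pow n p)"
  by (simp add: lam_pow_def)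

lemma pCons_0_sum: "pCons 0 (\<Sum>i\<in>I. f i) = (\<Sum>i\<in>I. pCons 0 (f i))"
proof (induction I rule: infinite_finite_induct)
  case (insert i I)
  from insert.hyps show ?case
    by (simp flip: insert.IH)
qed simp_all

lemma lam_pow_add: "lam_pow (m + n) p = lam_pow m (lam_pow n p)"
  by (simp add: lam_pow_def funpow_add)

lemma lam_pow_sum: "lam_pow n (\<Sum>i\<in>I. f i) = (\<Sum>i\<in>I. lam_pow n (f i))"
  by (induction n) (simp_all add: pCons_0_sum)

lemma lam_pow_zero [simp]: "lam_pow n 0 = 0"
  by (induction n) simp_all

lemma lam_pow_plus:
  fixes p q :: "'w::comm_monoid_add poly"
  shows "lam_pow n (p + q) = lam_pow n p + lam_pow n q"
  by (induction n) simp_all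

lemma lam_pow_shift: "lam_pow n (pCons 0 p) = pCons 0 (lam_pow n p)"
  by (induction n) simp_all

text \<open>Extension in several arguments is iterated extension in one argument.\<close>

lemma lam_ext2_eq: "lam_ext2 f p q = lam_ext1 (\<lambda>x. lam_ext1 (f x) q) p"
  by (simp add: lam_ext2_def lam_ext1_def lam_pow_sum lam_pow_add)

lemma lam_ext3_eq: "lam_ext3 f p q s = lam_ext1 (\<lambda>x. lam_ext2 (f x) q s) p"
  by (simp add: lam_ext3_def lam_ext2_def lam_ext1_def lam_pow_sum lam_pow_add add.assoc)

lemma lam_ext1_const [simp]: "lam_ext1 f [:x:] = f x"
  by (simp add: lam_ext1_def)

lemma lam_ext2_const [simp]: "lam_ext2 f [:x:] [:y:] = f x y"
  by (simp add: lam_ext2_eq)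

lemma lam_ext3_const [simp]: "lam_ext3 f [:x:] [:y:] [:z:] = f x y z"
  by (simp add: lam_ext3_eq)

lemma lam_ext1_plus: "lam_ext1 (\<lambda>x. f x + g x) p = lam_ext1 f p + lam_ext1 g p"
  by (simp add: lam_ext1_def lam_pow_plus sum.distrib)

lemma lam_ext1_shift: "lam_ext1 (\<lambda>x. pCons 0 (f x)) p = pCons 0 (lam_ext1 f p)"
  by (simp add: lam_ext1_def lam_pow_shift pCons_0_sum)

lemma lam_ext1_eq_sum:
  fixes f :: "'v::ab_group_add \<Rightarrow> 'w::ab_group_add poly"
  assumes "additive f" "degree p \<le> n"
  shows "lam_ext1 f p = (\<Sum>i\<le>n. lam_pow i (f (coeff p i)))"
  unfolding lam_ext1_def using assms(2)
  by (intro sum.mono_neutral_left) (auto simp: coeff_eq_0 additive.zero[OF assms(1)])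

lemma lam_linear_ext1:
  fixes f :: "'v::ab_group_add \<Rightarrow> 'w::ab_group_add poly"
  assumes f: "additive f"
  shows "lam_linear (lam_ext1 f)"
proof (rule lam_linearI)
  fix p q :: "'v poly"
  define n where "n = max (degree p) (degree q)"
  have "degree (p + q) \<le> n"
    by (simp add: n_def degree_add_le)
  then show "lam_ext1 f (p + q) = lam_ext1 f p + lam_ext1 f q"
    using lam_ext1_eq_sum[OF f, of p n] lam_ext1_eq_sum[OF f, of q n]
      lam_ext1_eq_sum[OF f, of "p + q" n]
    by (simp add: n_def additive.add[OF f] lam_pow_plus sum.distrib)
next
  fix p :: "'v poly"
  have "lam_ext1 f (pCons 0 p) =
      (\<Sum>i\<le>Suc (degree p). lam_pow i (f (coeff (pCons 0 p) i)))"
    by (intro lam_ext1_eq_sum f degree_pCons_le)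
  also have "\<dots> = pCons 0 (lam_ext1 f p)"
    by (simp add: sum.atMost_Suc_shift additive.zero[OF f] lam_ext1_def pCons_0_sum
        del: sum.atMost_Suc)
  finally show "lam_ext1 f (pCons 0 p) = pCons 0 (lam_ext1 f p)" .
qed

lemma additive_lam_ext1:
  assumes "\<And>y. additive (\<lambda>x. f x y)"
  shows "additive (\<lambda>x. lam_ext1 (f x) q)"
proof (rule additive.intro)
  fix x x'
  have "f (x + x') = (\<lambda>y. f x y + f x' y)"
    using additive.add[OF assms] by (rule ext)
  then show "lam_ext1 (f (x + x')) q = lam_ext1 (f x) q + lam_ext1 (f x') q"
    by (simp add: lam_ext1_plus)
qed

lemma lam_linear_lam_ext1_param:
  assumes "\<And>x. lam_linear (f x)"
  shows "lam_linear (\<lambda>q. lam_ext1 (\<lambda>x. f x q) p)"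
  by (rule lam_linearI)
    (simp_all add: lam_linear_add[OF assms] lam_linear_shift[OF assms]
      lam_ext1_plus lam_ext1_shift)

lemma lam_linear_ext2_left:
  assumes "\<And>y. additive (\<lambda>x. f x y)"
  shows "lam_linear (\<lambda>p. lam_ext2 f p q)"
  unfolding lam_ext2_eq by (intro lam_linear_ext1 additive_lam_ext1 assms)

lemma lam_linear_ext2_right:
  assumes "\<And>x. additive (\<lambda>y. f x y)"
  shows "lam_linear (\<lambda>q. lam_ext2 f p q)"
  unfolding lam_ext2_eq by (intro lam_linear_lam_ext1_param lam_linear_ext1 assms)

lemma lam_linear_ext3_first:
  assumes "\<And>y z. additive (\<lambda>x. f x y z)"
  shows "lam_linear (\<lambda>p. lam_ext3 f p q s)"
  unfolding lam_ext3_eq lam_ext2_eq by (intro lam_linear_ext1 additive_lam_ext1 assms)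

lemma lam_linear_ext3_second:
  assumes "\<And>x z. additive (\<lambda>y. f x y z)"
  shows "lam_linear (\<lambda>q. lam_ext3 f p q s)"
  unfolding lam_ext3_eq by (intro lam_linear_lam_ext1_param lam_linear_ext2_left assms)

lemma lam_linear_ext3_third:
  assumes "\<And>x y. additive (\<lambda>z. f x y z)"
  shows "lam_linear (\<lambda>s. lam_ext3 f p q s)"
  unfolding lam_ext3_eq by (intro lam_linear_lam_ext1_param lam_linear_ext2_right assms)

section \<open>The module structure over the polynomial ring\<close>

lemma lam_scale_const [simp]: "lam_scale s [:c:] [:v:] = [:s c v:]"
  by (simp add: lam_scale_def)

context module
begin

lemma lam_linear_scale_left: "lam_linear (\<lambda>c. lam_scale scale c v)"
  unfolding lam_scale_def
  by (intro lam_linear_ext2_left additive.intro) (simp add: scale_left_distrib)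

lemma lam_linear_scale_right: "lam_linear (\<lambda>v. lam_scale scale c v)"
  unfolding lam_scale_def
  by (intro lam_linear_ext2_right additive.intro) (simp add: scale_right_distrib)

lemma lam_scale_pair: "lam_scale scale [:c:] [:v, w:] = [:scale c v, scale c w:]"
  by (simp add: lam_linear_pCons[OF lam_linear_scale_right, of _ v "[:w:]"])

lemma module_lam_scale: "module (lam_scale scale)"
proof
  fix a b :: "'a poly" and x y :: "'b poly"
  show "lam_scale scale a (x + y) = lam_scale scale a x + lam_scale scale a y"
    by (rule lam_linear_add[OF lam_linear_scale_right])
  show "lam_scale scale (a + b) x = lam_scale scale a x + lam_scale scale b x"
    by (rule lam_linear_add[OF lam_linear_scale_left])
  have "(\<forall>a b x. lam_scale scale a (lam_scale scale b x) = lam_scale scale (a * b) x) \<longleftrightarrow>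
      (\<forall>a b x. lam_scale scale [:a:] (lam_scale scale [:b:] [:x:]) =
        lam_scale scale ([:a:] * [:b:]) [:x:])"
    by (rule lam_linear_eq_iff3)
      (intro lam_linear_compose[OF lam_linear_scale_left] lam_linear_scale_left
        lam_linear_compose[OF lam_linear_scale_right] lam_linear_scale_right
        lam_linear_mult_left lam_linear_mult_right)+
  then show "lam_scale scale a (lam_scale scale b x) = lam_scale scale (a * b) x"
    by (simp add: mult.commute)
  have "lam_scale scale [:1:] x = x"
    by (rule lam_linear_eqI[OF lam_linear_scale_right lam_linear_ident]) simp
  then show "lam_scale scale 1 x = x"
    by (simp add: one_pCons)
qed

end

text \<open>
  A \<open>\<lambda>\<close>-linear map is \<open>k[\<lambda>]\<close>-linear once it commutes with scalars from \<open>k\<close> on constants.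
\<close>

lemma module_hom_lam_scaleI:
  assumes "module s" "module s'" and f: "lam_linear f"
    and scale: "\<And>c v. f [:s c v:] = lam_scale s' [:c:] (f [:v:])"
  shows "module_hom (lam_scale s) (lam_scale s') f"
proof -
  interpret S: module s by fact
  interpret S': module s' by fact
  have "(\<forall>c v. f (lam_scale s c v) = lam_scale s' c (f v)) \<longleftrightarrow>
      (\<forall>c v. f (lam_scale s [:c:] [:v:]) = lam_scale s' [:c:] (f [:v:]))"
    by (rule lam_linear_eq_iff2)
      (intro lam_linear_compose[OF f] S.lam_linear_scale_left S.lam_linear_scale_right
        S'.lam_linear_scale_left lam_linear_compose[OF S'.lam_linear_scale_right] f)+
  then have "f (lam_scale s c v) = lam_scale s' c (f v)" for c v
    by (simp add: scale)
  then show ?thesis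
    by (simp add: module_hom_iff S.module_lam_scale S'.module_lam_scale lam_linear_add[OF f])
qed

section \<open>Linear extensions of first-order deformations\<close>

lemma additive_pair:
  assumes "module_hom s s' f" "module_hom s s' g"
  shows "additive (\<lambda>x. [:f x, g x:])"
  by (rule additive.intro) (simp add: module_hom.add[OF assms(1)] module_hom.add[OF assms(2)])

lemma additive_pair_bilinear:
  assumes "bilinear_map su sv sw f" "bilinear_map su sv sw g"
  shows "additive (\<lambda>x. [:f x y, g x y:])" "additive (\<lambda>y. [:f x y, g x y:])"
  using assms
  by (auto simp: bilinear_map_def intro: additive_pair[of su sw] additive_pair[of sv sw])

lemma additive_pair_trilinear:
  assumes "trilinear_map su sv st sw f" "trilinear_map su sv st sw g"
  shows "additive (\<lambda>x. [:f x y z, g x y z:])"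
    and "additive (\<lambda>y. [:f x y z, g x y z:])"
    and "additive (\<lambda>z. [:f x y z, g x y z:])"
  using assms unfolding trilinear_map_def
  by (simp_all add: additive_pair[of su sw] additive_pair[of sv sw] additive_pair[of st sw])

lemma module_hom_lam_ext1:
  assumes f: "module_hom s s' f" and g: "module_hom s s' g"
  shows "module_hom (lam_scale s) (lam_scale s') (lam_ext1 (\<lambda>x. [:f x, g x:]))"
proof (rule module_hom_lam_scaleI)
  interpret f: module_hom s s' f by fact
  interpret g: module_hom s s' g by fact
  show "module s" "module s'" by unfold_locales
  show "lam_linear (lam_ext1 (\<lambda>x. [:f x, g x:]))"
    by (intro lam_linear_ext1 additive_pair[OF f g])
  show "lam_ext1 (\<lambda>x. [:f x, g x:]) [:s c v:] =
      lam_scale s' [:c:] (lam_ext1 (\<lambda>x. [:f x, g x:]) [:v:])" for c v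
    by (simp add: f.scale g.scale f.m2.lam_scale_pair)
qed

text \<open>
  For an operation with several arguments, linearity in one of them is checked with the others
  arbitrary; these are reduced to constants by \<open>\<lambda>\<close>-linearity.
\<close>

lemma bilinear_map_lam_ext2:
  assumes f: "bilinear_map su sv sw f" and g: "bilinear_map su sv sw g"
  shows "bilinear_map (lam_scale su) (lam_scale sv) (lam_scale sw)
    (lam_ext2 (\<lambda>x y. [:f x y, g x y:]))"
proof -
  have f1: "module_hom su sw (\<lambda>x. f x y)" and f2: "module_hom sv sw (\<lambda>y. f x y)"
    and g1: "module_hom su sw (\<lambda>x. g x y)" and g2: "module_hom sv sw (\<lambda>y. g x y)" for x y
    using f g by (auto simp: bilinear_map_def)
  have su: "module su" and sv: "module sv" and sw: "module sw"
    using f1 f2 by (auto simp: module_hom_iff)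
  interpret sw: module sw by (fact sw)
  let ?F = "lam_ext2 (\<lambda>x y. [:f x y, g x y:])"
  have lin1: "lam_linear (\<lambda>p. ?F p q)" and lin2: "lam_linear (\<lambda>q. ?F p q)" for p q
    by (intro lam_linear_ext2_left lam_linear_ext2_right
        additive_pair_bilinear[OF f g])+
  have "module_hom (lam_scale sv) (lam_scale sw) (\<lambda>q. ?F p q)" for p
  proof (rule module_hom_lam_scaleI[OF sv sw lin2])
    show "?F p [:sv c y:] = lam_scale sw [:c:] (?F p [:y:])" for c y
      by (rule lam_linear_eqI[OF lin1 lam_linear_compose[OF sw.lam_linear_scale_right lin1]])
        (simp add: sw.lam_scale_pair module_hom.scale[OF f2] module_hom.scale[OF g2])
  qed
  moreover have "module_hom (lam_scale su) (lam_scale sw) (\<lambda>p. ?F p q)" for q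
  proof (rule module_hom_lam_scaleI[OF su sw lin1])
    show "?F [:su c x:] q = lam_scale sw [:c:] (?F [:x:] q)" for c x
      by (rule lam_linear_eqI[OF lin2 lam_linear_compose[OF sw.lam_linear_scale_right lin2]])
        (simp add: sw.lam_scale_pair module_hom.scale[OF f1] module_hom.scale[OF g1])
  qed
  ultimately show ?thesis
    by (simp add: bilinear_map_def)
qed

lemma trilinear_map_lam_ext3:
  assumes f: "trilinear_map su sv st sw f" and g: "trilinear_map su sv st sw g"
  shows "trilinear_map (lam_scale su) (lam_scale sv) (lam_scale st) (lam_scale sw)
    (lam_ext3 (\<lambda>x y z. [:f x y z, g x y z:]))"
proof -
  have f1: "module_hom su sw (\<lambda>x. f x y z)" and f2: "module_hom sv sw (\<lambda>y. f x y z)"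
    and f3: "module_hom st sw (\<lambda>z. f x y z)"
    and g1: "module_hom su sw (\<lambda>x. g x y z)" and g2: "module_hom sv sw (\<lambda>y. g x y z)"
    and g3: "module_hom st sw (\<lambda>z. g x y z)" for x y z
    using f g by (auto simp: trilinear_map_def)
  have su: "module su" and sv: "module sv" and st: "module st" and sw: "module sw"
    using f1 f2 f3 by (auto simp: module_hom_iff)
  interpret sw: module sw by (fact sw)
  let ?F = "lam_ext3 (\<lambda>x y z. [:f x y z, g x y z:])"
  have lin1: "lam_linear (\<lambda>p. ?F p q s)" and lin2: "lam_linear (\<lambda>q. ?F p q s)"
    and lin3: "lam_linear (\<lambda>s. ?F p q s)" for p q s
    by (intro lam_linear_ext3_first lam_linear_ext3_second lam_linear_ext3_third
        additive_pair_trilinear[OF f g])+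
  note scale_lin = lam_linear_compose[OF sw.lam_linear_scale_right]
  have "module_hom (lam_scale su) (lam_scale sw) (\<lambda>p. ?F p q s)" for q s
  proof (rule module_hom_lam_scaleI[OF su sw lin1])
    fix c x
    have "(\<forall>q s. ?F [:su c x:] q s = lam_scale sw [:c:] (?F [:x:] q s)) \<longleftrightarrow>
        (\<forall>y z. ?F [:su c x:] [:y:] [:z:] = lam_scale sw [:c:] (?F [:x:] [:y:] [:z:]))"
      by (rule lam_linear_eq_iff2[OF lin2 scale_lin[OF lin2] lin3 scale_lin[OF lin3]])
    then show "?F [:su c x:] q s = lam_scale sw [:c:] (?F [:x:] q s)"
      by (simp add: sw.lam_scale_pair module_hom.scale[OF f1] module_hom.scale[OF g1])
  qed
  moreover have "module_hom (lam_scale sv) (lam_scale sw) (\<lambda>q. ?F p q s)" for p s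
  proof (rule module_hom_lam_scaleI[OF sv sw lin2])
    fix c y
    have "(\<forall>p s. ?F p [:sv c y:] s = lam_scale sw [:c:] (?F p [:y:] s)) \<longleftrightarrow>
        (\<forall>x z. ?F [:x:] [:sv c y:] [:z:] = lam_scale sw [:c:] (?F [:x:] [:y:] [:z:]))"
      by (rule lam_linear_eq_iff2[OF lin1 scale_lin[OF lin1] lin3 scale_lin[OF lin3]])
    then show "?F p [:sv c y:] s = lam_scale sw [:c:] (?F p [:y:] s)"
      by (simp add: sw.lam_scale_pair module_hom.scale[OF f2] module_hom.scale[OF g2])
  qed
  moreover have "module_hom (lam_scale st) (lam_scale sw) (\<lambda>s. ?F p q s)" for p q
  proof (rule module_hom_lam_scaleI[OF st sw lin3])
    fix c z
    have "(\<forall>p q. ?F p q [:st c z:] = lam_scale sw [:c:] (?F p q [:z:])) \<longleftrightarrow>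
        (\<forall>x y. ?F [:x:] [:y:] [:st c z:] = lam_scale sw [:c:] (?F [:x:] [:y:] [:z:]))"
      by (rule lam_linear_eq_iff2[OF lin1 scale_lin[OF lin1] lin2 scale_lin[OF lin2]])
    then show "?F p q [:st c z:] = lam_scale sw [:c:] (?F p q [:z:])"
      by (simp add: sw.lam_scale_pair module_hom.scale[OF f3] module_hom.scale[OF g3])
  qed
  ultimately show ?thesis
    by (simp add: trilinear_map_def)
qed

section \<open>The axioms of the deformed structure\<close>

text \<open>
  An associative 2-algebra together with candidate first-order terms, of which only linearity is
  assumed.
\<close>

locale first_order_deformation =
  A: associative_2_algebra s0 s1 d m l r l3 + B: two_algebra_data s0 s1 \<psi> \<omega> \<mu> \<nu> \<theta>
  for s0 :: "'k::comm_ring_1 \<Rightarrow> 'a::ab_group_add \<Rightarrow> 'a"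
    and s1 :: "'k \<Rightarrow> 'b::ab_group_add \<Rightarrow> 'b"
    and d m l r l3 \<psi> \<omega> \<mu> \<nu> \<theta>
begin

notation m (infixl \<open>\<cdot>\<close> 70) and l (infixl \<open>\<rhd>\<close> 70) and r (infixl \<open>\<lhd>\<close> 70)

text \<open>The deformed differential, products and trilinear map, on polynomials in \<open>\<lambda>\<close>.\<close>

definition "D = lam_ext1 (\<lambda>a. [:d a, \<psi> a:])"
definition "M = lam_ext2 (\<lambda>x y. [:x \<cdot> y, \<omega> x y:])"
definition "L = lam_ext2 (\<lambda>x a. [:x \<rhd> a, \<mu> x a:])"
definition "R = lam_ext2 (\<lambda>a x. [:a \<lhd> x, \<nu> a x:])"
definition "T = lam_ext3 (\<lambda>x y z. [:l3 x y z, \<theta> x y z:])"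

lemma two_algebra_data_deformed: "two_algebra_data (lam_scale s0) (lam_scale s1) D M L R T"
  unfolding D_def M_def L_def R_def T_def
  by (intro two_algebra_data.intro module_hom_lam_ext1 bilinear_map_lam_ext2
      trilinear_map_lam_ext3 A.d_linear A.m_bilinear A.l_bilinear A.r_bilinear A.l3_trilinear
      B.d_linear B.m_bilinear B.l_bilinear B.r_bilinear B.l3_trilinear)

lemma D_lin: "lam_linear D"
  and M_lin: "lam_linear (\<lambda>p. M p q)" "lam_linear (\<lambda>q. M p q)"
  and L_lin: "lam_linear (\<lambda>p. L p u)" "lam_linear (\<lambda>u. L p u)"
  and R_lin: "lam_linear (\<lambda>u. R u p)" "lam_linear (\<lambda>p. R u p)"
  and T_lin: "lam_linear (\<lambda>p. T p q s)" "lam_linear (\<lambda>q. T p q s)" "lam_linear (\<lambda>s. T p q s)"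
  unfolding D_def M_def L_def R_def T_def
  by (intro lam_linear_ext1 lam_linear_ext2_left lam_linear_ext2_right
      lam_linear_ext3_first lam_linear_ext3_second lam_linear_ext3_third
      additive_pair[OF A.d_linear B.d_linear]
      additive_pair_bilinear[OF A.m_bilinear B.m_bilinear]
      additive_pair_bilinear[OF A.l_bilinear B.l_bilinear]
      additive_pair_bilinear[OF A.r_bilinear B.r_bilinear]
      additive_pair_trilinear[OF A.l3_trilinear B.l3_trilinear])+

lemmas lin =
  lam_linear_ident lam_linear_plus lam_linear_minus lam_linear_compose[OF D_lin]
  lam_linear_compose[OF M_lin(1)] lam_linear_compose[OF M_lin(2)]
  lam_linear_compose[OF L_lin(1)] lam_linear_compose[OF L_lin(2)]
  lam_linear_compose[OF R_lin(1)] lam_linear_compose[OF R_lin(2)]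
  lam_linear_compose[OF T_lin(1)] lam_linear_compose[OF T_lin(2)]
  lam_linear_compose[OF T_lin(3)]

text \<open>
  Values on constants and, in one argument, on polynomials of degree at most 1: no other values
  occur when the axioms are evaluated on constants.
\<close>

lemma deformed_const:
  "D [:a:] = [:d a, \<psi> a:]" "M [:x:] [:y:] = [:x \<cdot> y, \<omega> x y:]"
  "L [:x:] [:a:] = [:x \<rhd> a, \<mu> x a:]" "R [:a:] [:x:] = [:a \<lhd> x, \<nu> a x:]"
  "T [:x:] [:y:] [:z:] = [:l3 x y z, \<theta> x y z:]"
  by (simp_all add: D_def M_def L_def R_def T_def)

lemma deformed_pair:
  "D [:a, b:] = [:d a, d b + \<psi> a, \<psi> b:]"
  "M [:x, x':] [:y:] = [:x \<cdot> y, x' \<cdot> y + \<omega> x y, \<omega> x' y:]"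
  "M [:x:] [:y, y':] = [:x \<cdot> y, x \<cdot> y' + \<omega> x y, \<omega> x y':]"
  "L [:x, x':] [:a:] = [:x \<rhd> a, x' \<rhd> a + \<mu> x a, \<mu> x' a:]"
  "L [:x:] [:a, b:] = [:x \<rhd> a, x \<rhd> b + \<mu> x a, \<mu> x b:]"
  "R [:a, b:] [:x:] = [:a \<lhd> x, b \<lhd> x + \<nu> a x, \<nu> b x:]"
  "R [:a:] [:x, x':] = [:a \<lhd> x, a \<lhd> x' + \<nu> a x, \<nu> a x':]"
  "T [:x, x':] [:y:] [:z:] = [:l3 x y z, l3 x' y z + \<theta> x y z, \<theta> x' y z:]"
  "T [:x:] [:y, y':] [:z:] = [:l3 x y z, l3 x y' z + \<theta> x y z, \<theta> x y' z:]"
  "T [:x:] [:y:] [:z, z':] = [:l3 x y z, l3 x y z' + \<theta> x y z, \<theta> x y z':]"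
  by (simp_all add: deformed_const add.commute
      lam_linear_pCons[OF D_lin, of _ "[:_:]"]
      lam_linear_pCons[OF M_lin(1), of _ "[:_:]"] lam_linear_pCons[OF M_lin(2), of _ _ "[:_:]"]
      lam_linear_pCons[OF L_lin(1), of _ "[:_:]"] lam_linear_pCons[OF L_lin(2), of _ _ "[:_:]"]
      lam_linear_pCons[OF R_lin(1), of _ "[:_:]"] lam_linear_pCons[OF R_lin(2), of _ _ "[:_:]"]
      lam_linear_pCons[OF T_lin(1), of _ "[:_:]"] lam_linear_pCons[OF T_lin(2), of _ _ "[:_:]"]
      lam_linear_pCons[OF T_lin(3), of _ _ _ "[:_:]"])

lemma deformed_d_l:
  "(\<forall>x a. D (L x a) = M x (D a)) \<longleftrightarrow>
    (\<forall>x a. x \<cdot> \<psi> a - \<psi> (x \<rhd> a) + \<omega> x (d a) - d (\<mu> x a) = 0) \<and>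
    (\<forall>x a. \<psi> (\<mu> x a) = \<omega> x (\<psi> a))"
proof -
  have "(\<forall>x a. D (L x a) = M x (D a)) \<longleftrightarrow> (\<forall>x a. D (L [:x:] [:a:]) = M [:x:] (D [:a:]))"
    by (rule lam_linear_eq_iff2) (intro lin)+
  then show ?thesis
    by (auto simp: deformed_const deformed_pair A.d_l algebra_simps)
qed

lemma deformed_d_r:
  "(\<forall>a x. D (R a x) = M (D a) x) \<longleftrightarrow>
    (\<forall>x a. \<psi> a \<cdot> x - \<psi> (a \<lhd> x) + \<omega> (d a) x - d (\<nu> a x) = 0) \<and>
    (\<forall>a x. \<psi> (\<nu> a x) = \<omega> (\<psi> a) x)"
proof -
  have "(\<forall>a x. D (R a x) = M (D a) x) \<longleftrightarrow> (\<forall>a x. D (R [:a:] [:x:]) = M (D [:a:]) [:x:])"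
    by (rule lam_linear_eq_iff2) (intro lin)+
  then show ?thesis
    by (auto simp: deformed_const deformed_pair A.d_r algebra_simps)
qed

lemma deformed_peiffer:
  "(\<forall>a b. L (D a) b = R a (D b)) \<longleftrightarrow>
    (\<forall>a b. a \<lhd> \<psi> b + \<nu> a (d b) - \<psi> a \<rhd> b - \<mu> (d a) b = 0) \<and>
    (\<forall>a b. \<mu> (\<psi> a) b = \<nu> a (\<psi> b))"
proof -
  have "(\<forall>a b. L (D a) b = R a (D b)) \<longleftrightarrow> (\<forall>a b. L (D [:a:]) [:b:] = R [:a:] (D [:b:]))"
    by (rule lam_linear_eq_iff2) (intro lin)+
  then show ?thesis
    by (auto simp: deformed_const deformed_pair A.peiffer algebra_simps)
qed

lemma deformed_d_l3:
  "(\<forall>x y z. D (T x y z) = M (M x y) z - M x (M y z)) \<longleftrightarrow>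
    (\<forall>x y z. \<omega> x y \<cdot> z - x \<cdot> \<omega> y z + \<omega> (x \<cdot> y) z - \<omega> x (y \<cdot> z)
      = d (\<theta> x y z) + \<psi> (l3 x y z)) \<and>
    (\<forall>x y z. \<psi> (\<theta> x y z) = \<omega> (\<omega> x y) z - \<omega> x (\<omega> y z))"
proof -
  have "(\<forall>x y z. D (T x y z) = M (M x y) z - M x (M y z)) \<longleftrightarrow>
      (\<forall>x y z. D (T [:x:] [:y:] [:z:]) = M (M [:x:] [:y:]) [:z:] - M [:x:] (M [:y:] [:z:]))"
    by (rule lam_linear_eq_iff3) (intro lin)+
  then show ?thesis
    by (auto simp: deformed_const deformed_pair A.d_l3 algebra_simps)
qed

lemma deformed_l3_d3:
  "(\<forall>x y a. T x y (D a) = L (M x y) a - L x (L y a)) \<longleftrightarrow>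
    (\<forall>x y a. \<omega> x y \<rhd> a - x \<rhd> \<mu> y a + \<mu> (x \<cdot> y) a - \<mu> x (y \<rhd> a)
      = \<theta> x y (d a) + l3 x y (\<psi> a)) \<and>
    (\<forall>x y a. \<theta> x y (\<psi> a) = \<mu> (\<omega> x y) a - \<mu> x (\<mu> y a))"
proof -
  have "(\<forall>x y a. T x y (D a) = L (M x y) a - L x (L y a)) \<longleftrightarrow>
      (\<forall>x y a. T [:x:] [:y:] (D [:a:]) = L (M [:x:] [:y:]) [:a:] - L [:x:] (L [:y:] [:a:]))"
    by (rule lam_linear_eq_iff3) (intro lin)+
  then show ?thesis
    by (auto simp: deformed_const deformed_pair A.l3_d3 algebra_simps)
qed

lemma deformed_l3_d2:
  "(\<forall>x a y. T x (D a) y = R (L x a) y - L x (R a y)) \<longleftrightarrow>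
    (\<forall>x y a. \<mu> x a \<lhd> y - x \<rhd> \<nu> a y + \<nu> (x \<rhd> a) y - \<mu> x (a \<lhd> y)
      = \<theta> x (d a) y + l3 x (\<psi> a) y) \<and>
    (\<forall>x a y. \<theta> x (\<psi> a) y = \<nu> (\<mu> x a) y - \<mu> x (\<nu> a y))"
proof -
  have "(\<forall>x a y. T x (D a) y = R (L x a) y - L x (R a y)) \<longleftrightarrow>
      (\<forall>x a y. T [:x:] (D [:a:]) [:y:] = R (L [:x:] [:a:]) [:y:] - L [:x:] (R [:a:] [:y:]))"
    by (rule lam_linear_eq_iff3) (intro lin)+
  then show ?thesis
    by (auto simp: deformed_const deformed_pair A.l3_d2 algebra_simps)
qed

lemma deformed_l3_d1:
  "(\<forall>a x y. T (D a) x y = R (R a x) y - R a (M x y)) \<longleftrightarrow>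
    (\<forall>x y a. \<nu> a x \<lhd> y - a \<lhd> \<omega> x y + \<nu> (a \<lhd> x) y - \<nu> a (x \<cdot> y)
      = \<theta> (d a) x y + l3 (\<psi> a) x y) \<and>
    (\<forall>a x y. \<theta> (\<psi> a) x y = \<nu> (\<nu> a x) y - \<nu> a (\<omega> x y))"
proof -
  have "(\<forall>a x y. T (D a) x y = R (R a x) y - R a (M x y)) \<longleftrightarrow>
      (\<forall>a x y. T (D [:a:]) [:x:] [:y:] = R (R [:a:] [:x:]) [:y:] - R [:a:] (M [:x:] [:y:]))"
    by (rule lam_linear_eq_iff3) (intro lin)+
  then show ?thesis
    by (auto simp: deformed_const deformed_pair A.l3_d1 algebra_simps)
qed

lemma deformed_pentagon:
  "(\<forall>x y z t. L x (T y z t) + R (T x y z) t =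
      T (M x y) z t - T x (M y z) t + T x y (M z t)) \<longleftrightarrow>
    (\<forall>x y z t. x \<rhd> \<theta> y z t + \<theta> x y z \<lhd> t + \<mu> x (l3 y z t) + \<nu> (l3 x y z) t
      = \<theta> (x \<cdot> y) z t - \<theta> x (y \<cdot> z) t + \<theta> x y (z \<cdot> t)
        + l3 (\<omega> x y) z t - l3 x (\<omega> y z) t + l3 x y (\<omega> z t)) \<and>
    (\<forall>x y z t. \<mu> x (\<theta> y z t) + \<nu> (\<theta> x y z) t =
      \<theta> (\<omega> x y) z t - \<theta> x (\<omega> y z) t + \<theta> x y (\<omega> z t))"
proof -
  have "(\<forall>x y z t. L x (T y z t) + R (T x y z) t =
        T (M x y) z t - T x (M y z) t + T x y (M z t)) \<longleftrightarrow>
      (\<forall>x y z t. L [:x:] (T [:y:] [:z:] [:t:]) + R (T [:x:] [:y:] [:z:]) [:t:] =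
        T (M [:x:] [:y:]) [:z:] [:t:] - T [:x:] (M [:y:] [:z:]) [:t:]
          + T [:x:] [:y:] (M [:z:] [:t:]))"
    by (rule lam_linear_eq_iff4) (intro lin)+
  then show ?thesis
    by (auto simp: deformed_const deformed_pair A.pentagon algebra_simps)
qed

theorem generates_infinitesimal_deformation_iff:
  "A.generates_infinitesimal_deformation \<psi> \<omega> \<mu> \<nu> \<theta> \<longleftrightarrow>
    A.adjoint_2_cocycle \<psi> \<omega> \<mu> \<nu> \<theta> \<and> associative_2_algebra s0 s1 \<psi> \<omega> \<mu> \<nu> \<theta>"
proof -
  have "A.generates_infinitesimal_deformation \<psi> \<omega> \<mu> \<nu> \<theta> \<longleftrightarrow>
      associative_2_algebra (lam_scale s0) (lam_scale s1) D M L R T"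
    by (simp only: A.generates_infinitesimal_deformation_def D_def M_def L_def R_def T_def)
  then show ?thesis
    by (simp only: associative_2_algebra_def associative_2_algebra_axioms_def
        two_algebra_data_deformed B.two_algebra_data_axioms A.adjoint_2_cocycle_def
        deformed_d_l deformed_d_r deformed_peiffer deformed_d_l3
        deformed_l3_d3 deformed_l3_d2 deformed_l3_d1 deformed_pentagon simp_thms conj_ac)
qed

end

section \<open>Infinitesimal deformations and cocycles\<close>

theorem theorem3p1:
  fixes s0 :: "'k::field \<Rightarrow> 'a::ab_group_add \<Rightarrow> 'a"
    and s1 :: "'k \<Rightarrow> 'b::ab_group_add \<Rightarrow> 'b"
    and d \<psi> :: "'b \<Rightarrow> 'a"
    and m \<omega> :: "'a \<Rightarrow> 'a \<Rightarrow> 'a"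
    and l \<mu> :: "'a \<Rightarrow> 'b \<Rightarrow> 'b"
    and r \<nu> :: "'b \<Rightarrow> 'a \<Rightarrow> 'b"
    and l3 \<theta> :: "'a \<Rightarrow> 'a \<Rightarrow> 'a \<Rightarrow> 'b"
  assumes "vector_space s0" and "vector_space s1"
    and "associative_2_algebra s0 s1 d m l r l3"
    and "module_hom s1 s0 \<psi>"
    and "bilinear_map s0 s0 s0 \<omega>"
    and "bilinear_map s0 s1 s1 \<mu>"
    and "bilinear_map s1 s0 s1 \<nu>"
    and "trilinear_map s0 s0 s0 s1 \<theta>"
  shows "two_algebra_data.generates_infinitesimal_deformation s0 s1 d m l r l3 \<psi> \<omega> \<mu> \<nu> \<theta> \<longleftrightarrow>
    two_algebra_data.adjoint_2_cocycle d m l r l3 \<psi> \<omega> \<mu> \<nu> \<theta> \<and>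
    associative_2_algebra s0 s1 \<psi> \<omega> \<mu> \<nu> \<theta>"
proof -
  interpret first_order_deformation s0 s1 d m l r l3 \<psi> \<omega> \<mu> \<nu> \<theta>
    using assms by (intro first_order_deformation.intro two_algebra_data.intro)
  show ?thesis
    by (rule generates_infinitesimal_deformation_iff)
qed

end
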